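(* Let $k\geqslant3$ and $1\leqslant d\leqslant k-1$ with $k-d\geqslant d$. For all $n\geqslant k$ and $1\leqslant m\leqslant k-d$, $$A(n,m)=\sum_{i=0}^{m+d}(-1)^i\binom{m+d-i}{i}f_{n-i}.$$
   Context: A permutation $\pi\in\mathfrak S_n$ avoids a pattern $\tau\in\mathfrak S_k$ if no subsequence of $\pi$ of length $k$ is order-isomorphic to $\tau$. For $a,b\geqslant1$, $w(a,b)=(a,a-1,\dots,1,a+b,a+b-1,\dots,a+1)$. Let $T^{d,k}=\{(1,2,3),w(k-d,d)\}$ and let $f_n$ be the number of permutations in $\mathfrak S_n$ avoiding both patterns of $T^{d,k}$ ($f_0=1$). For $n\geqslant1$, $1\leqslant m\leqslant n$ and $i_1,\dots,i_m\in\{1,\dots,n\}$, $g_n(i_1,\dots,i_m)$ is the number of such avoiding permutations $\pi\in\mathfrak S_n$ with $\pi_j=i_j$ for $j=1,\dots,m$. For positive integers $n,m$, let $\mathcal I(n,m)$ be the set of integer tuples $(i_1,\dots,i_m)$ with $m-j\leqslant i_{j+1}\leqslant i_j-1$ for $j=0,\dots,m-1$, where $i_0:=n-d+1$ (i.e. $n-d\geqslant i_1>\dots>i_m\geqslant1$), and $A(n,m)=\sum_{(i_1,\dots,i_m)\in\mathcal I(n,m)}g_n(i_1,\dots,i_m)$. *)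

theory Defs
  imports "HOL-Library.Sublist" "HOL-Combinatorics.Multiset_Permutations"
begin

(* Permutations of {1..n} are given in one-line notation, as the lists in
   permutations_of_set {1..n}; subseq is the library's (not necessarily contiguous)
   subsequence relation on lists. *)

definition order_isomorphic :: "nat list \<Rightarrow> nat list \<Rightarrow> bool" where
  "order_isomorphic xs ys \<longleftrightarrow>
     length xs = length ys \<and>
     (\<forall>i<length xs. \<forall>j<length xs. xs ! i < xs ! j \<longleftrightarrow> ys ! i < ys ! j)"

definition avoids :: "nat list \<Rightarrow> nat list \<Rightarrow> bool" where
  "avoids p t \<longleftrightarrow> \<not> (\<exists>s. subseq s p \<and> order_isomorphic s t)"

definition w_pattern :: "nat \<Rightarrow> nat \<Rightarrow> nat list" where
  "w_pattern a b = rev [1..<a + 1] @ rev [a + 1..<a + b + 1]"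

definition T_patterns :: "nat \<Rightarrow> nat \<Rightarrow> nat list set" where
  "T_patterns d k = {[1, 2, 3], w_pattern (k - d) d}"

definition avoiders :: "nat \<Rightarrow> nat \<Rightarrow> nat \<Rightarrow> nat list set" where
  "avoiders d k n = {p \<in> permutations_of_set {1..n}. \<forall>t \<in> T_patterns d k. avoids p t}"

definition f_count :: "nat \<Rightarrow> nat \<Rightarrow> nat \<Rightarrow> nat" where
  "f_count d k n = card (avoiders d k n)"

definition g_count :: "nat \<Rightarrow> nat \<Rightarrow> nat \<Rightarrow> nat list \<Rightarrow> nat" where
  "g_count d k n is = card {p \<in> avoiders d k n. take (length is) p = is}"

(* The list is = [i_1, ..., i_m] has i_{j+1} = is ! j, and i_j is entry j of the list with
   i_0 = n - d + 1 prepended. All entries are forced to be positive, so natural numbers lose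
   nothing against integers; where n + 1 - d truncates, the set is empty either way (m > 0). *)
definition I_tuples :: "nat \<Rightarrow> nat \<Rightarrow> nat \<Rightarrow> nat list set" where
  "I_tuples d n m =
     {is. length is = m \<and> (\<forall>j<m. m - j \<le> is ! j \<and> is ! j < ((n + 1 - d) # is) ! j)}"

definition A_sum :: "nat \<Rightarrow> nat \<Rightarrow> nat \<Rightarrow> nat \<Rightarrow> nat" where
  "A_sum d k n m = (\<Sum>is \<in> I_tuples d n m. g_count d k n is)"

lemma w_pattern_3_2: "w_pattern 3 2 = [3, 2, 1, 5, 4]"
  by (simp add: w_pattern_def upt_rec)

lemma f_count_0:
  assumes "1 \<le> d"
  shows "f_count d k 0 = 1"
proof -
  have "avoids [] t" if "t \<in> T_patterns d k" for t
  proof -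
    have "length t \<noteq> 0"
      using that assms by (auto simp: T_patterns_def w_pattern_def)
    then show ?thesis
      by (auto simp: avoids_def order_isomorphic_def dest: list_emb_length)
  qed
  then have "avoiders d k 0 = {[]}"
    by (auto simp: avoiders_def)
  then show ?thesis by (simp add: f_count_def)
qed

lemma finite_I_tuples: "finite (I_tuples d n m)"
proof (rule finite_subset)
  show "I_tuples d n m \<subseteq> {is. set is \<subseteq> {..n + 1} \<and> length is = m}"
  proof
    fix xs assume "xs \<in> I_tuples d n m"
    then have len: "length xs = m" and dec: "\<And>j. j < m \<Longrightarrow> xs ! j < ((n + 1 - d) # xs) ! j"
      by (auto simp: I_tuples_def)
    have "xs ! j \<le> n + 1" if "j < m" for j
      using that
    proof (induction j)
      case 0
      then show ?case using dec[of 0] by simp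
    next
      case (Suc j)
      then show ?case using dec[of "Suc j"] by simp
    qed
    then show "xs \<in> {is. set is \<subseteq> {..n + 1} \<and> length is = m}"
      using len by (auto simp: in_set_conv_nth)
  qed
  show "finite {is. set is \<subseteq> {..n + 1} \<and> length is = m}"
    by (rule finite_lists_length_eq) simp
qed

end

theory Submission
  imports Defs
begin

text \<open>
  Let $R(n,p)$ be the right-hand side with $p = m + d$; Pascal's rule gives
  $R(n,p+2) = R(n,p+1) - R(n-1,p)$. Let $F(n,m,x)$ count the avoiders whose first $m$ entries
  decrease and whose first entry is at most $n-x$, so that $A(n,m) = F(n,m,d)$; the claim is
  $F(n,m,x) = R(n,m+x)$ for $x \leq d$.

  If the first $m$ entries decrease, the first is not $n$, and the next entry is an ascent, then
  avoidance of 123 forces that entry to be $n$. For $m < k-d$ this $n$ lies too far left to take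
  part in the second layer of the pattern $w$, so it can be deleted and reinserted freely. This
  gives $F(n,m,x) - F(n,m+1,x) = F(n-1,m,x-1)$ for $x \geq 1$; deleting a leading $n$ covers
  $x = 0$.

  For $m = 1$ one needs the number of avoiders starting with $n-x$, where $x < d$. Too few larger
  entries follow for the first entry to belong to a copy of $w$, so deleting it leaves exactly the
  avoiders of length $n-1$ whose $x$ largest values appear in decreasing order. Counting these,
  $E(n-1,x)$, mirrors $F(n-1,x,0)$ for the patterns with $d$ and $k-d$ exchanged, under the symmetry
  inverse-reverse-complement, and satisfies
  $E(n,x+1) = E(n,x) - E(n-1,x-1)$.
\<close>

subsection \<open>The alternating binomial sum\<close>

text \<open>The coefficients are those of the Chebyshev polynomial of the second kind $U_p$; those
  with 2i > p vanish. Integer values make room for the signs.\<close>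

definition chebyshev_sum :: "(nat \<Rightarrow> nat) \<Rightarrow> nat \<Rightarrow> nat \<Rightarrow> int" where
  "chebyshev_sum f n p = (\<Sum>i = 0..p. (- 1) ^ i * int ((p - i) choose i) * int (f (n - i)))"

lemma chebyshev_sum_0 [simp]: "chebyshev_sum f n 0 = int (f n)"
  by (simp add: chebyshev_sum_def)

lemma chebyshev_sum_1 [simp]: "chebyshev_sum f n (Suc 0) = int (f n)"
  by (simp add: chebyshev_sum_def)

text \<open>Pascal's rule on each coefficient, after splitting off the term i = 0. The shift of
  \<open>i\<close> by one flips the sign and turns \<open>Suc n\<close> into \<open>n\<close>. This
  is the three-term recurrence of the Chebyshev polynomials, and every counting identity below is
  matched against it.\<close>

lemma chebyshev_sum_rec:
  "chebyshev_sum f (Suc n) (Suc (Suc p)) = chebyshev_sum f (Suc n) (Suc p) - chebyshev_sum f n p"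
proof -
  define t where "t q i = (- 1) ^ i * int ((q - i) choose i) * int (f (Suc n - i))" for q i
  define u where "u i = (- 1) ^ i * int ((p - i) choose i) * int (f (n - i))" for i
  have t0: "t q 0 = int (f (Suc n))" for q
    by (simp add: t_def)
  have pascal: "t (Suc (Suc p)) (Suc i) = t (Suc p) (Suc i) - u i" if "i \<le> p" for i
    using that by (simp add: t_def u_def Suc_diff_le algebra_simps)
  have "chebyshev_sum f (Suc n) (Suc (Suc p)) = (\<Sum>i\<le>Suc (Suc p). t (Suc (Suc p)) i)"
    by (simp add: chebyshev_sum_def t_def atMost_atLeast0)
  also have "\<dots> = t (Suc (Suc p)) 0 + (\<Sum>i\<le>Suc p. t (Suc (Suc p)) (Suc i))"
    by (rule sum.atMost_Suc_shift)
  \<comment> \<open>The top term carries the coefficient \<open>0 choose Suc (Suc p)\<close>, which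
    is 0.\<close>
  also have "(\<Sum>i\<le>Suc p. t (Suc (Suc p)) (Suc i)) = (\<Sum>i\<le>p. t (Suc (Suc p)) (Suc i))"
    by (simp add: t_def)
  also have "\<dots> = (\<Sum>i\<le>p. t (Suc p) (Suc i)) - (\<Sum>i\<le>p. u i)"
    by (simp add: pascal sum_subtractf)
  also have "t (Suc (Suc p)) 0 + \<dots> = (\<Sum>i\<le>Suc p. t (Suc p) i) - (\<Sum>i\<le>p. u i)"
    by (simp add: t0 sum.atMost_Suc_shift del: sum.atMost_Suc)
  finally show ?thesis
    by (simp add: chebyshev_sum_def t_def u_def atMost_atLeast0)
qed

subsection \<open>Pattern avoidance\<close>

text \<open>Puts sortedness into the language of two-element subsequences, so that it can be
  compared directly with pattern containment.\<close>

lemma subseq_pair_sorted_wrt: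
  "sorted_wrt P xs \<longleftrightarrow> (\<forall>a b. subseq [a, b] xs \<longrightarrow> P a b)"
proof (induction xs)
  case (Cons x xs)
  have "subseq [a, b] (x # xs) \<longleftrightarrow> subseq [a, b] xs \<or> a = x \<and> b \<in> set xs" for a b
    by (auto simp: subseq_singleton_left dest: subseq_Cons')
  with Cons show ?case by auto
qed simp

lemma order_isomorphic_123_iff:
  "order_isomorphic s [1, 2, 3] \<longleftrightarrow> (\<exists>a b c. s = [a, b, c] \<and> a < b \<and> b < c)"
  by (auto simp: order_isomorphic_def length_Suc_conv less_Suc_eq numeral_3_eq_3)

lemma avoids_123_iff:
  "avoids p [1, 2, 3] \<longleftrightarrow> (\<forall>a b c. subseq [a, b, c] p \<longrightarrow> a < b \<longrightarrow> \<not> b < c)"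
  unfolding avoids_def order_isomorphic_123_iff by blast

lemma avoids_subseq: "avoids p t \<Longrightarrow> subseq q p \<Longrightarrow> avoids q t"
  unfolding avoids_def by (meson subseq_order.trans)


lemma subseq_set_subset: "subseq s p \<Longrightarrow> set s \<subseteq> set p"
  by (auto simp: subseq_conv_nths dest: in_set_nthsD)

lemma subseq_distinct: "subseq s p \<Longrightarrow> distinct p \<Longrightarrow> distinct s"
  by (auto simp: subseq_conv_nths)

lemma subseq_filter_iff: "subseq s (filter P p) \<longleftrightarrow> subseq s p \<and> (\<forall>v\<in>set s. P v)"
proof
  assume sub: "subseq s (filter P p)"
  then have "\<forall>v\<in>set s. P v"
    using subseq_set_subset[OF sub] by auto
  with sub show "subseq s p \<and> (\<forall>v\<in>set s. P v)"
    using subseq_order.trans[OF sub subseq_filter_left] by blast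
next
  assume *: "subseq s p \<and> (\<forall>v\<in>set s. P v)"
  then have "filter P s = s" by (simp add: filter_id_conv)
  with * show "subseq s (filter P p)"
    using subseq_filter[of s p P] by simp
qed

lemma subseq_insertD:
  assumes "subseq s (u @ x # v)"
  shows "subseq s (u @ v) \<or> (\<exists>s1 s2. s = s1 @ x # s2 \<and> subseq s1 u \<and> subseq s2 v)"
proof -
  obtain s1 t where s: "s = s1 @ t" "subseq s1 u" "subseq t (x # v)"
    using assms by (auto simp: subseq_append_iff)
  from s(3) show ?thesis
  proof cases
    case list_emb_Nil
    then show ?thesis using s by auto
  next
    case list_emb_Cons
    then show ?thesis using s by (auto intro: list_emb_append_mono)
  next
    case list_emb_Cons2
    then show ?thesis using s by auto
  qed
qed

text \<open>A copy of 123 through the head \<open>x\<close> is the same as an ascent among the later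
  entries above \<open>x\<close>. Distinctness turns the absence of ascents into strict
  decrease.\<close>

lemma avoids_123_Cons_iff:
  assumes "distinct (x # p)"
  shows "avoids (x # p) [1, 2, 3] \<longleftrightarrow>
    avoids p [1, 2, 3] \<and> sorted_wrt (>) (filter (\<lambda>v. x < v) p)"
proof -
  have sub: "subseq [a, b, c] (x # p) \<longleftrightarrow> subseq [a, b, c] p \<or> a = x \<and> subseq [b, c] p" for a b c
    using subseq_Cons'[of a "[b, c]" p] by (cases "a = x") auto
  have desc: "sorted_wrt (>) (filter (\<lambda>v. x < v) p) \<longleftrightarrow>
      (\<forall>b c. subseq [b, c] p \<longrightarrow> x < b \<longrightarrow> \<not> b < c)"
  proof -
    have "(subseq [b, c] p \<and> (\<forall>v\<in>set [b, c]. x < v) \<longrightarrow> c < b) \<longleftrightarrow>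
        (subseq [b, c] p \<longrightarrow> x < b \<longrightarrow> \<not> b < c)" for b c
      using subseq_distinct[of "[b, c]" p] assms by auto
    then show ?thesis
      by (simp only: subseq_pair_sorted_wrt subseq_filter_iff)
  qed
  have "(\<forall>a b c. subseq [a, b, c] p \<or> a = x \<and> subseq [b, c] p \<longrightarrow> a < b \<longrightarrow> \<not> b < c) \<longleftrightarrow>
      (\<forall>a b c. subseq [a, b, c] p \<longrightarrow> a < b \<longrightarrow> \<not> b < c) \<and>
      (\<forall>b c. subseq [b, c] p \<longrightarrow> x < b \<longrightarrow> \<not> b < c)"
    by metis
  then show ?thesis
    by (simp only: avoids_123_iff sub desc)
qed

section \<open>Invariance under increasing relabelling\<close>

lemma order_isomorphic_map:
  assumes "strict_mono_on (set s) f"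
  shows "order_isomorphic (map f s) t \<longleftrightarrow> order_isomorphic s t"
proof -
  have "f (s ! i) < f (s ! j) \<longleftrightarrow> s ! i < s ! j" if "i < length s" "j < length s" for i j
    using that strict_mono_on_less[OF assms] by simp
  then have "(\<forall>i<length s. \<forall>j<length s. f (s ! i) < f (s ! j) \<longleftrightarrow> t ! i < t ! j) \<longleftrightarrow>
      (\<forall>i<length s. \<forall>j<length s. s ! i < s ! j \<longleftrightarrow> t ! i < t ! j)"
    by metis
  then show ?thesis by (simp add: order_isomorphic_def)
qed

lemma subseq_map_iff: "subseq s (map f p) \<longleftrightarrow> (\<exists>s'. s = map f s' \<and> subseq s' p)"
proof
  assume "subseq s (map f p)"
  then obtain N where "s = nths (map f p) N"
    by (auto simp: subseq_conv_nths)
  then have "s = map f (nths p N)" by (simp only: nths_map)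
  moreover have "subseq (nths p N) p" by (auto simp only: subseq_conv_nths)
  ultimately show "\<exists>s'. s = map f s' \<and> subseq s' p" by blast
next
  assume "\<exists>s'. s = map f s' \<and> subseq s' p"
  then obtain s' where "s = map f s'" "subseq s' p" by blast
  then show "subseq s (map f p)" by (simp only: subseq_map)
qed

text \<open>Pattern containment sees only relative order. This permits renaming the values to
  \<open>{1..n}\<close> once an entry has been deleted.\<close>

lemma avoids_map:
  assumes "strict_mono_on (set p) f"
  shows "avoids (map f p) t \<longleftrightarrow> avoids p t"
proof -
  have iso: "order_isomorphic (map f s) t \<longleftrightarrow> order_isomorphic s t" if "subseq s p" for s
    by (rule order_isomorphic_map[OF monotone_on_subset[OF assms subseq_set_subset[OF that]]])
  have "(\<exists>s. subseq s (map f p) \<and> order_isomorphic s t) \<longleftrightarrow>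
      (\<exists>s. subseq s p \<and> order_isomorphic (map f s) t)"
    by (simp only: subseq_map_iff ex_simps simp_thms) metis
  also have "\<dots> \<longleftrightarrow> (\<exists>s. subseq s p \<and> order_isomorphic s t)"
    by (simp only: iso cong: conj_cong)
  finally show ?thesis by (simp only: avoids_def)
qed

section \<open>The layered pattern, and insertions that create no forbidden copy\<close>

lemma length_w_pattern [simp]: "length (w_pattern a b) = a + b"
  by (simp add: w_pattern_def)

lemma w_pattern_nth_low: "j < a \<Longrightarrow> w_pattern a b ! j = a - j"
  by (simp add: w_pattern_def nth_append rev_nth del: upt_Suc)

lemma w_pattern_nth_high: "a \<le> j \<Longrightarrow> j < a + b \<Longrightarrow> w_pattern a b ! j = 2 * a + b - j"
  by (simp add: w_pattern_def nth_append rev_nth del: upt_Suc)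

text \<open>Apart from the length, this is the one property of the pattern that the two insertion
  arguments below rely on: the first layer lies wholly below the second.\<close>

lemma w_pattern_low_less_high:
  "i < a \<Longrightarrow> a \<le> j \<Longrightarrow> j < a + b \<Longrightarrow> w_pattern a b ! i < w_pattern a b ! j"
  by (simp add: w_pattern_nth_low w_pattern_nth_high)

text \<open>A new copy must start with \<open>x\<close>, which then belongs to the first layer. Its
  second layer would supply \<open>b\<close> distinct entries of \<open>p\<close> above
  \<open>x\<close>, more than there are.\<close>

lemma avoids_w_pattern_ConsI:
  assumes "avoids p (w_pattern a b)" "distinct p" "0 < a" "card {v \<in> set p. x < v} < b"
  shows "avoids (x # p) (w_pattern a b)"
  unfolding avoids_def
proof
  assume "\<exists>s. subseq s (x # p) \<and> order_isomorphic s (w_pattern a b)"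
  then obtain s where s: "subseq s (x # p)" "order_isomorphic s (w_pattern a b)"
    by blast
  then have "\<not> subseq s p"
    using assms(1) by (auto simp: avoids_def)
  with subseq_insertD[of s "[]" x p] s(1) obtain s' where s': "s = x # s'" "subseq s' p"
    by (auto dest: list_emb_Nil2)
  have len: "length s = a + b"
    using s(2) by (simp add: order_isomorphic_def)
  have "x < s ! j" if "a \<le> j" "j < a + b" for j
    using w_pattern_low_less_high[OF assms(3) that] s(2) len that s'(1) assms(3)
    unfolding order_isomorphic_def by (metis add_gr_0 nth_Cons_0)
  then have "\<forall>v\<in>set (drop a s). x < v"
    by (auto simp: in_set_conv_nth len)
  \<comment> \<open>Since \<open>a\<close> is positive, dropping \<open>a\<close> entries removes
    the head \<open>x\<close>, so the second layer comes from \<open>p\<close>.\<close>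
  moreover have "set (drop a s) \<subseteq> set p"
    using s' assms(3) subseq_set_subset[OF s'(2)] set_drop_subset[of "a - 1" s']
    by (cases a) auto
  ultimately have "card (set (drop a s)) \<le> card {v \<in> set p. x < v}"
    by (intro card_mono) auto
  moreover have "distinct (drop a s)"
    using s' assms(2,3) subseq_distinct[OF s'(2)] by (cases a) auto
  then have "card (set (drop a s)) = b"
    by (simp add: distinct_card len)
  ultimately show False
    using assms(4) by simp
qed

text \<open>A new copy uses \<open>x\<close>, preceded by at most \<open>length u\<close> of its
  entries, so \<open>x\<close> sits in the first layer. The entry of the copy at index
  \<open>a\<close>, in the second layer, would then exceed the maximum \<open>x\<close>.\<close>

lemma avoids_w_pattern_insertI:
  assumes "avoids (u @ v) (w_pattern a b)" "0 < b" "length u < a" "\<forall>z \<in> set (u @ v). z \<le> x"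
  shows "avoids (u @ x # v) (w_pattern a b)"
  unfolding avoids_def
proof
  assume "\<exists>s. subseq s (u @ x # v) \<and> order_isomorphic s (w_pattern a b)"
  then obtain s where s: "subseq s (u @ x # v)" "order_isomorphic s (w_pattern a b)"
    by blast
  then have "\<not> subseq s (u @ v)"
    using assms(1) by (auto simp: avoids_def)
  with subseq_insertD[OF s(1)]
  obtain s1 s2 where s': "s = s1 @ x # s2" "subseq s1 u" "subseq s2 v"
    by blast
  have "length s1 < a"
    using list_emb_length[OF s'(2)] assms(3) by simp
  moreover have len: "length s = a + b"
    using s(2) by (simp add: order_isomorphic_def)
  ultimately have "s ! length s1 < s ! a"
    using s(2) w_pattern_low_less_high[of "length s1" a a b] assms(2)
    unfolding order_isomorphic_def by simp
  then have "x < s ! a"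
    using s'(1) by simp
  moreover have "s ! a \<in> set s"
    using len assms(2) by simp
  then have "s ! a \<in> set (u @ x # v)"
    using subseq_set_subset[OF s(1)] by blast
  then have "s ! a \<le> x"
    using assms(4) by auto
  ultimately show False by simp
qed

text \<open>The maximum \<open>x\<close> can only play the role of 3, and then 1 and 2 would form an
  ascent in the decreasing list \<open>u\<close>.\<close>

lemma avoids_123_insertI:
  assumes "avoids (u @ v) [1, 2, 3]" "sorted_wrt (>) u" "\<forall>z \<in> set (u @ v). z \<le> x"
  shows "avoids (u @ x # v) [1, 2, 3]"
  unfolding avoids_123_iff
proof (intro allI impI notI)
  fix a b c
  assume sub: "subseq [a, b, c] (u @ x # v)" and lt: "a < b" "b < c"
  then have "\<not> subseq [a, b, c] (u @ v)"
    using assms(1) unfolding avoids_123_iff by blast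
  with subseq_insertD[OF sub] obtain s1 s2
    where s: "[a, b, c] = s1 @ x # s2" "subseq s1 u" "subseq s2 v"
    by blast
  have "set s1 \<union> set s2 \<subseteq> set (u @ v)"
    using subseq_set_subset[OF s(2)] subseq_set_subset[OF s(3)] by auto
  then have le: "z \<le> x" if "z \<in> set s1 \<union> set s2" for z
    using assms(3) that by blast
  from s(1) consider "s1 = []" "x = a" "s2 = [b, c]" | "s1 = [a]" "x = b" "s2 = [c]"
    | "s1 = [a, b]" "x = c" "s2 = []"
    by (auto simp: Cons_eq_append_conv)
  then show False
  proof cases
    case 3
    then have "subseq [a, b] u" using s(2) by simp
    then show False
      using assms(2) lt unfolding subseq_pair_sorted_wrt by (meson order_less_asym)
  qed (use le[of c] lt in auto)
qed

subsection \<open>Inserting and deleting the maximum\<close>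

lemma avoiders_iff:
  "p \<in> avoiders d k n \<longleftrightarrow> distinct p \<and> set p = {1..n} \<and>
     avoids p [1, 2, 3] \<and> avoids p (w_pattern (k - d) d)"
  by (auto simp: avoiders_def T_patterns_def permutations_of_set_def)

lemma finite_avoiders [simp]: "finite (avoiders d k n)"
  by (simp add: avoiders_def)

lemma length_avoiders: "p \<in> avoiders d k n \<Longrightarrow> length p = n"
  using distinct_card[of p] by (simp add: avoiders_iff)

text \<open>Deletion passes to a subsequence, so it preserves avoidance. Insertion is safe because
  the short prefix keeps the maximum out of the second layer and the decreasing prefix rules out
  123.\<close>

lemma insert_max_avoiders_iff:
  assumes "1 \<le> d" "length u < k - d" "sorted_wrt (>) u"
  shows "u @ Suc n # v \<in> avoiders d k (Suc n) \<longleftrightarrow> u @ v \<in> avoiders d k n"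
proof -
  have perm: "distinct (u @ Suc n # v) \<and> set (u @ Suc n # v) = {1..Suc n} \<longleftrightarrow>
      distinct (u @ v) \<and> set (u @ v) = {1..n}" (is "?L \<longleftrightarrow> ?R")
  proof
    assume ?L
    then have "set (u @ v) = {1..Suc n} - {Suc n}" by auto
    with \<open>?L\<close> show ?R by (auto simp: atLeastAtMostSuc_conv)
  next
    assume R: ?R
    then have "Suc n \<notin> set (u @ v)" by (metis Suc_n_not_le_n atLeastAtMost_iff)
    then have "Suc n \<notin> set u" "Suc n \<notin> set v" by simp_all
    with R show ?L by (auto simp: atLeastAtMostSuc_conv)
  qed
  have sub: "subseq (u @ v) (u @ Suc n # v)"
    by (simp add: subseq_append' list_emb_Cons)
  show ?thesis
  proof
    assume "u @ Suc n # v \<in> avoiders d k (Suc n)"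
    then show "u @ v \<in> avoiders d k n"
      unfolding avoiders_iff using perm avoids_subseq[OF _ sub] by blast
  next
    assume "u @ v \<in> avoiders d k n"
    then have *: "distinct (u @ v) \<and> set (u @ v) = {1..n}" "avoids (u @ v) [1, 2, 3]"
      "avoids (u @ v) (w_pattern (k - d) d)"
      unfolding avoiders_iff by blast+
    then have le: "\<forall>z \<in> set (u @ v). z \<le> Suc n"
      by (metis atLeastAtMost_iff le_SucI)
    have "0 < d" using assms(1) by simp
    then show "u @ Suc n # v \<in> avoiders d k (Suc n)"
      unfolding avoiders_iff
      using perm * avoids_123_insertI[OF *(2) assms(3) le]
        avoids_w_pattern_insertI[OF *(3) _ assms(2) le] by blast
  qed
qed

lemma Cons_max_avoiders_iff:
  assumes "1 \<le> d" "d < k"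
  shows "Suc n # v \<in> avoiders d k (Suc n) \<longleftrightarrow> v \<in> avoiders d k n"
  using insert_max_avoiders_iff[of d "[]" k n v] assms by simp

section \<open>The two restricted families of avoiders\<close>

text \<open>Its cardinality is $F(n,m,x)$. The bound on the head is additive to avoid truncated
  subtraction. As \<open>hd []\<close> is unspecified, the identities below keep the length
  positive.\<close>

definition desc_prefix :: "nat \<Rightarrow> nat \<Rightarrow> nat \<Rightarrow> nat \<Rightarrow> nat \<Rightarrow> nat list set" where
  "desc_prefix d k n m x =
     {p \<in> avoiders d k n. sorted_wrt (>) (take m p) \<and> hd p + x \<le> n}"

text \<open>Its cardinality is $E(n,x)$: the filter keeps the values above n - x, again written
  without subtraction.\<close>

definition desc_top :: "nat \<Rightarrow> nat \<Rightarrow> nat \<Rightarrow> nat \<Rightarrow> nat list set" where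
  "desc_top d k n x = {p \<in> avoiders d k n. sorted_wrt (>) (filter (\<lambda>v. n < v + x) p)}"

lemma finite_desc [simp]: "finite (desc_prefix d k n m x)" "finite (desc_top d k n x)"
  by (simp_all add: desc_prefix_def desc_top_def)

lemma sorted_wrt_take_mono: "sorted_wrt P (take n p) \<Longrightarrow> m \<le> n \<Longrightarrow> sorted_wrt P (take m p)"
  using sorted_wrt_take[of P "take n p" m] by (simp add: min_def)

text \<open>The permutations lost when \<open>m\<close> grows are those with an ascent into index
  \<open>m\<close>, and there the entry must be \<open>Suc n\<close>. Deleting it keeps the head and
  shortens the permutation by one, so the slack drops from \<open>Suc x\<close> to
  \<open>x\<close>.\<close>

lemma card_desc_prefix_ascent:
  assumes "1 \<le> d" "1 \<le> m" "m < k - d" "m \<le> n"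
  shows "card (desc_prefix d k (Suc n) m (Suc x)) =
    card (desc_prefix d k (Suc n) (Suc m) (Suc x)) + card (desc_prefix d k n m x)"
proof -
  define D where "D = desc_prefix d k (Suc n) m (Suc x) - desc_prefix d k (Suc n) (Suc m) (Suc x)"
  have "bij_betw (\<lambda>q. take m q @ Suc n # drop m q) (desc_prefix d k n m x) D"
  proof (rule bij_betw_byWitness[where f' = "\<lambda>p. take m p @ drop (Suc m) p"])
    have "take m q @ Suc n # drop m q \<in> D" if q: "q \<in> desc_prefix d k n m x" for q
    proof -
      have q': "q \<in> avoiders d k n" "sorted_wrt (>) (take m q)" "hd q + x \<le> n"
        using q by (auto simp: desc_prefix_def)
      have len: "length q = n" using q'(1) by (rule length_avoiders)
      have "take m q @ Suc n # drop m q \<in> avoiders d k (Suc n)"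
        using insert_max_avoiders_iff[of d "take m q" k n "drop m q"] assms q' by simp
      moreover have take_q: "take m q = hd q # tl (take m q)"
        using len assms by (cases q) (auto simp: take_Cons split: nat.splits)
      then have hd_q: "hd (take m q @ Suc n # drop m q) = hd q"
        by (metis append_Cons list.sel(1))
      have "hd q \<in> set (take m q)"
        by (subst take_q) simp
      \<comment> \<open>The head is at most \<open>n\<close>, so appending \<open>Suc n\<close>
        breaks the decrease; this places the image in \<open>D\<close>.\<close>
      then have "\<not> sorted_wrt (>) (take m q @ [Suc n])"
        using q'(3) unfolding sorted_wrt_append by fastforce
      moreover have "take m (take m q @ Suc n # drop m q) = take m q"
        "take (Suc m) (take m q @ Suc n # drop m q) = take m q @ [Suc n]"
        using len assms by simp_all
      ultimately show ?thesis
        using q' hd_q by (simp add: D_def desc_prefix_def)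
    qed
    then show "(\<lambda>q. take m q @ Suc n # drop m q) ` desc_prefix d k n m x \<subseteq> D"
      by blast
    have D: "p = take m p @ Suc n # drop (Suc m) p \<and>
        take m p @ drop (Suc m) p \<in> desc_prefix d k n m x" if "p \<in> D" for p
    proof -
      have p: "p \<in> avoiders d k (Suc n)" "sorted_wrt (>) (take m p)" "hd p + Suc x \<le> Suc n"
        "\<not> sorted_wrt (>) (take (Suc m) p)"
        using that by (auto simp: D_def desc_prefix_def)
      have len: "length p = Suc n" using p(1) by (rule length_avoiders)
      have dist: "distinct p" and set_p: "set p = {1..Suc n}" and av: "avoids p [1, 2, 3]"
        using p(1) by (auto simp: avoiders_iff)
      have split: "p = take m p @ p ! m # drop (Suc m) p"
        using len assms by (simp add: id_take_nth_drop)
      have "take (Suc m) p = take m p @ [p ! m]"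
        using len assms by (simp add: take_Suc_conv_app_nth)
      then obtain z where z: "z \<in> set (take m p)" "\<not> p ! m < z"
        using p(2,4) by (auto simp: sorted_wrt_append)
      moreover have "z \<noteq> p ! m"
        using dist z(1) by (subst (asm) split) auto
      ultimately have zlt: "z < p ! m" by simp
      have take_p: "take m p = hd p # tl (take m p)"
        using len assms by (cases p) (auto simp: take_Cons split: nat.splits)
      \<comment> \<open>The head is the largest entry of the decreasing prefix and is at most
        \<open>n\<close>.\<close>
      have "Suc n \<notin> set (take m p)"
      proof
        assume "Suc n \<in> set (take m p)"
        then have "Suc n \<le> hd p"
          using p(2) take_p by (metis less_imp_le set_ConsD sorted_wrt.simps(2) order_refl)
        then show False using p(3) by simp
      qed
      \<comment> \<open>If \<open>Suc n\<close> came after index \<open>m\<close>, then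
        \<open>z\<close>, \<open>p ! m\<close>, \<open>Suc n\<close> would be a copy of 123.\<close>
      moreover have "Suc n \<notin> set (drop (Suc m) p)"
      proof
        assume last: "Suc n \<in> set (drop (Suc m) p)"
        then have "subseq ([z] @ [p ! m] @ [Suc n]) (take m p @ [p ! m] @ drop (Suc m) p)"
          using z(1) by (intro list_emb_append_mono) (auto simp: subseq_singleton_left)
        then have "subseq [z, p ! m, Suc n] p"
          using split by simp
        moreover have "p ! m \<noteq> Suc n"
          using dist last by (subst (asm) split) auto
        moreover have "p ! m \<in> set p"
          using len assms by simp
        then have "p ! m \<le> Suc n"
          using set_p by simp
        ultimately show False
          using av zlt unfolding avoids_123_iff by (metis le_neq_implies_less)
      qed
      moreover have "Suc n \<in> set (take m p @ p ! m # drop (Suc m) p)"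
        using set_p split by simp
      ultimately have "p ! m = Suc n" by auto
      with split have split': "p = take m p @ Suc n # drop (Suc m) p" by simp
      have "take m p @ drop (Suc m) p \<in> avoiders d k n"
        using insert_max_avoiders_iff[of d "take m p" k n "drop (Suc m) p"] assms p split' by simp
      moreover have "hd (take m p @ drop (Suc m) p) = hd p"
        by (subst take_p) simp
      ultimately show ?thesis
        using p split' len assms by (simp add: desc_prefix_def min_def)
    qed
    then show "(\<lambda>p. take m p @ drop (Suc m) p) ` D \<subseteq> desc_prefix d k n m x"
      by blast
    show "\<forall>q\<in>desc_prefix d k n m x.
        take m (take m q @ Suc n # drop m q) @ drop (Suc m) (take m q @ Suc n # drop m q) = q"
      using assms by (auto simp: desc_prefix_def dest!: length_avoiders)
    have "take m (take m p @ drop (Suc m) p) = take m p"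
      "drop m (take m p @ drop (Suc m) p) = drop (Suc m) p" if "p \<in> D" for p
      using that assms by (auto simp: D_def desc_prefix_def dest!: length_avoiders)
    then show "\<forall>p\<in>D. take m (take m p @ drop (Suc m) p) @ Suc n #
        drop m (take m p @ drop (Suc m) p) = p"
      using D by metis
  qed
  then have "card (desc_prefix d k n m x) = card D"
    by (rule bij_betw_same_card)
  moreover have "desc_prefix d k (Suc n) (Suc m) (Suc x) \<subseteq> desc_prefix d k (Suc n) m (Suc x)"
    using sorted_wrt_take_mono[of "(>)" "Suc m" _ m] by (auto simp: desc_prefix_def)
  ultimately show ?thesis
    by (simp add: D_def card_Diff_subset card_mono)
qed

lemma avoiders_Suc_hd:
  assumes "p \<in> avoiders d k (Suc n)"
  shows "p = hd p # tl p" "1 \<le> hd p" "hd p \<le> Suc n"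
proof -
  have "p \<noteq> []" using length_avoiders[OF assms] by auto
  then show "p = hd p # tl p" by simp
  have "hd p \<in> {1..Suc n}"
    using assms hd_in_set[OF \<open>p \<noteq> []\<close>] unfolding avoiders_iff by metis
  then show "1 \<le> hd p" "hd p \<le> Suc n" by auto
qed

text \<open>Raising the slack from 0 to 1 excludes precisely the head \<open>Suc n\<close>, which
  can be deleted freely. The right-hand side puts no condition on the head of \<open>q\<close>, so
  that n = 0 is covered too.\<close>

lemma desc_prefix_hd_max_eq:
  assumes "1 \<le> d" "d < k"
  shows "desc_prefix d k (Suc n) (Suc m) 0 - desc_prefix d k (Suc n) (Suc m) 1 =
    (#) (Suc n) ` {q \<in> avoiders d k n. sorted_wrt (>) (take m q)}" (is "?L = ?R")
proof
  show "?L \<subseteq> ?R"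
  proof
    fix p assume p: "p \<in> ?L"
    then have *: "p \<in> avoiders d k (Suc n)" "sorted_wrt (>) (take (Suc m) p)" "hd p = Suc n"
      using avoiders_Suc_hd(3)[of p d k n] by (auto simp: desc_prefix_def)
    define q where "q = tl p"
    have pq: "p = Suc n # q"
      using avoiders_Suc_hd(1)[OF *(1)] *(3) by (simp add: q_def)
    then have "q \<in> avoiders d k n" "sorted_wrt (>) (take m q)"
      using * Cons_max_avoiders_iff[OF assms] by auto
    with pq show "p \<in> ?R" by blast
  qed
next
  show "?R \<subseteq> ?L"
  proof
    fix p assume "p \<in> ?R"
    then obtain q where q: "p = Suc n # q" "q \<in> avoiders d k n" "sorted_wrt (>) (take m q)"
      by blast
    have "\<forall>v\<in>set (take m q). v < Suc n"
      using q(2) set_take_subset[of m q] by (auto simp: avoiders_iff)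
    with q show "p \<in> ?L"
      using Cons_max_avoiders_iff[OF assms] by (auto simp: desc_prefix_def)
  qed
qed

lemma card_desc_prefix_hd_max:
  assumes "1 \<le> d" "d < k" "1 \<le> n"
  shows "card (desc_prefix d k (Suc n) (Suc m) 0) =
    card (desc_prefix d k (Suc n) (Suc m) 1) + card (desc_prefix d k n m 0)"
proof -
  have "{q \<in> avoiders d k n. sorted_wrt (>) (take m q)} = desc_prefix d k n m 0"
  proof -
    have "hd q \<le> n" if "q \<in> avoiders d k n" for q
      using avoiders_Suc_hd(3)[of q d k "n - 1"] that assms(3) by simp
    then show ?thesis by (auto simp: desc_prefix_def)
  qed
  with desc_prefix_hd_max_eq[OF assms(1,2)]
  have "card (desc_prefix d k (Suc n) (Suc m) 0 - desc_prefix d k (Suc n) (Suc m) 1) =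
      card (desc_prefix d k n m 0)"
    by (simp add: card_image)
  moreover have sub: "desc_prefix d k (Suc n) (Suc m) 1 \<subseteq> desc_prefix d k (Suc n) (Suc m) 0"
    by (auto simp: desc_prefix_def)
  ultimately show ?thesis
    using card_mono[OF finite_desc(1) sub] by (simp add: card_Diff_subset)
qed

text \<open>Both sides equal $F(n+1,m+1,1) + F(n,m,0)$, the left by deleting a leading maximum and
  the right by the ascent identity.\<close>

lemma card_desc_prefix_Suc_0:
  assumes "1 \<le> d" "1 \<le> m" "m < k - d" "m \<le> n"
  shows "card (desc_prefix d k (Suc n) (Suc m) 0) = card (desc_prefix d k (Suc n) m 1)"
  using card_desc_prefix_hd_max[of d k n m] card_desc_prefix_ascent[of d m k n 0] assms by simp

subsection \<open>Deleting a large first entry\<close>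

text \<open>The increasing map that skips the value \<open>h\<close>. It inverts the renaming done
  after a head \<open>h\<close> is deleted.\<close>

definition raise_from :: "nat \<Rightarrow> nat \<Rightarrow> nat" where
  "raise_from h v = (if h \<le> v then Suc v else v)"

lemma raise_from_less_iff [simp]: "raise_from h v < raise_from h w \<longleftrightarrow> v < w"
  by (auto simp: raise_from_def)

lemma strict_mono_on_raise_from: "strict_mono_on A (raise_from h)"
  by (auto intro: strict_mono_onI)

lemma inj_raise_from: "inj (raise_from h)"
  by (auto simp: inj_def raise_from_def split: if_splits)

lemma raise_from_greater_iff: "h < raise_from h v \<longleftrightarrow> h \<le> v"
  by (auto simp: raise_from_def)

lemma raise_from_image:
  assumes "1 \<le> h" "h \<le> Suc n"
  shows "raise_from h ` {1..n} = {1..Suc n} - {h}"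
proof
  show "{1..Suc n} - {h} \<subseteq> raise_from h ` {1..n}"
  proof
    fix w assume w: "w \<in> {1..Suc n} - {h}"
    show "w \<in> raise_from h ` {1..n}"
    proof (cases "w < h")
      case True
      then have "w = raise_from h w" "w \<in> {1..n}" using w assms by (auto simp: raise_from_def)
      then show ?thesis by (rule image_eqI)
    next
      case False
      then have "w = raise_from h (w - 1)" "w - 1 \<in> {1..n}"
        using w assms by (auto simp: raise_from_def)
      then show ?thesis by (rule image_eqI)
    qed
  qed
qed (use assms in \<open>auto simp: raise_from_def\<close>)

text \<open>The head has only x < d larger entries after it, too few for a second layer. The one
  remaining constraint, from 123, is that these entries decrease, and in \<open>q\<close> they are
  the \<open>x\<close> largest values.\<close>

lemma raise_from_Cons_avoiders_iff:
  assumes "x < d" "d < k" "x \<le> n"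
  shows "(Suc n - x) # map (raise_from (Suc n - x)) q \<in> avoiders d k (Suc n) \<longleftrightarrow>
    q \<in> desc_top d k n x"
proof -
  define h where "h = Suc n - x"
  define r where "r = map (raise_from h) q"
  have h: "1 \<le> h" "h \<le> Suc n" "h + x = Suc n" using assms by (auto simp: h_def)
  have "h \<notin> set r" by (auto simp: r_def raise_from_def)
  have "insert h A = B \<longleftrightarrow> A = B - {h}" if "h \<notin> A" "h \<in> B" for A B
    using that by blast
  with \<open>h \<notin> set r\<close> have "set (h # r) = {1..Suc n} \<longleftrightarrow> set r = {1..Suc n} - {h}"
    using h by (metis atLeastAtMost_iff list.simps(15))
  also have "\<dots> \<longleftrightarrow> raise_from h ` set q = raise_from h ` {1..n}"
    by (simp only: r_def set_map raise_from_image[OF h(1,2)])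
  also have "\<dots> \<longleftrightarrow> set q = {1..n}"
    by (rule inj_image_eq_iff[OF inj_raise_from])
  finally have set_iff: "set (h # r) = {1..Suc n} \<longleftrightarrow> set q = {1..n}" .
  have dist_iff: "distinct (h # r) \<longleftrightarrow> distinct q"
    using \<open>h \<notin> set r\<close> inj_on_subset[OF inj_raise_from] by (simp add: r_def distinct_map)
  have av: "avoids r t \<longleftrightarrow> avoids q t" for t
    unfolding r_def by (rule avoids_map[OF strict_mono_on_raise_from])
  \<comment> \<open>As \<open>h\<close> is n + 1 - x, both sides say that \<open>v\<close> is at
    least \<open>h\<close>.\<close>
  have "h < raise_from h v \<longleftrightarrow> n < v + x" for v
    using h by (auto simp: raise_from_greater_iff)
  then have "filter (\<lambda>v. h < v) r = map (raise_from h) (filter (\<lambda>v. n < v + x) q)"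
    by (simp only: r_def filter_map o_def)
  then have top: "sorted_wrt (>) (filter (\<lambda>v. h < v) r) \<longleftrightarrow>
      sorted_wrt (>) (filter (\<lambda>v. n < v + x) q)"
    by (simp add: sorted_wrt_map)
  \<comment> \<open>The premises bound the number of entries above \<open>h\<close> by
    \<open>x\<close>, since all values lie in \<open>{1..Suc n}\<close>.\<close>
  have w: "avoids (h # r) (w_pattern (k - d) d) \<longleftrightarrow> avoids r (w_pattern (k - d) d)"
    if "distinct (h # r)" "set (h # r) = {1..Suc n}"
  proof
    assume "avoids r (w_pattern (k - d) d)"
    moreover have "{v \<in> set r. h < v} \<subseteq> {h<..Suc n}"
      using that(2) by auto
    then have "card {v \<in> set r. h < v} \<le> x"
      using card_mono[of "{h<..Suc n}" "{v \<in> set r. h < v}"] h(3) by simp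
    ultimately show "avoids (h # r) (w_pattern (k - d) d)"
      using assms that(1) by (intro avoids_w_pattern_ConsI) auto
  next
    assume "avoids (h # r) (w_pattern (k - d) d)"
    then show "avoids r (w_pattern (k - d) d)"
      by (rule avoids_subseq) (simp add: list_emb_Cons)
  qed
  have "h # r \<in> avoiders d k (Suc n) \<longleftrightarrow> q \<in> desc_top d k n x"
    unfolding avoiders_iff desc_top_def mem_Collect_eq
    by (cases "distinct (h # r) \<and> set (h # r) = {1..Suc n}")
      (auto simp only: set_iff[symmetric] dist_iff[symmetric] av[symmetric] top[symmetric]
        w avoids_123_Cons_iff[of h r])
  then show ?thesis by (simp only: h_def r_def)
qed

lemma card_avoiders_hd:
  assumes "x < d" "d < k" "x \<le> n"
  shows "card {p \<in> avoiders d k (Suc n). hd p + x = Suc n} = card (desc_top d k n x)"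
proof -
  define h where "h = Suc n - x"
  have h: "1 \<le> h" "h \<le> Suc n" "h + x = Suc n" using assms by (auto simp: h_def)
  have "{p \<in> avoiders d k (Suc n). hd p + x = Suc n} =
      (\<lambda>q. h # map (raise_from h) q) ` desc_top d k n x" (is "?L = ?R")
  proof
    show "?R \<subseteq> ?L"
      using raise_from_Cons_avoiders_iff[OF assms] h(3) by (auto simp: h_def)
    show "?L \<subseteq> ?R"
    proof
      fix p assume p: "p \<in> ?L"
      then have "p = hd p # tl p" "hd p = h"
        using avoiders_Suc_hd(1)[of p d k n] h(3) by auto
      then obtain r where r: "p = h # r" by metis
      have "h \<notin> set r" "set (h # r) = {1..Suc n}"
        using p r by (auto simp: avoiders_iff)
      \<comment> \<open>Every tail entry is in the range of the relabelling, so the tail can be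
        pulled back to a list \<open>q\<close>.\<close>
      then have "set r \<subseteq> raise_from h ` {1..n}"
        using raise_from_image[OF h(1,2)] by auto
      then have "\<forall>w\<in>set r. \<exists>v. w = raise_from h v" by blast
      then obtain q where "r = map (raise_from h) q"
        by (metis ex_map_conv)
      moreover have "q \<in> desc_top d k n x"
        using raise_from_Cons_avoiders_iff[OF assms, of q] p r \<open>r = _\<close> by (simp add: h_def)
      ultimately show "p \<in> ?R" using r by blast
    qed
  qed
  moreover have "inj (\<lambda>q. h # map (raise_from h) q)"
    using inj_raise_from by (auto simp: inj_def map_injective)
  ultimately show ?thesis
    by (simp add: card_image inj_on_subset)
qed

subsection \<open>Largest values in decreasing order\<close>

lemma sorted_wrt_filter_iff:
  "sorted_wrt P (filter Q p) \<longleftrightarrow> (\<forall>a b. subseq [a, b] p \<longrightarrow> Q a \<longrightarrow> Q b \<longrightarrow> P a b)"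
  by (simp only: subseq_pair_sorted_wrt subseq_filter_iff) auto

lemma desc_top_iff:
  "p \<in> desc_top d k n x \<longleftrightarrow> p \<in> avoiders d k n \<and>
     (\<forall>a b. subseq [a, b] p \<longrightarrow> n < a + x \<longrightarrow> n < b + x \<longrightarrow> b < a)"
  by (simp only: desc_top_def sorted_wrt_filter_iff mem_Collect_eq)

lemma desc_top_0 [simp]: "desc_top d k n 0 = avoiders d k n"
proof -
  have "a \<le> n" if "subseq [a, b] p" "p \<in> avoiders d k n" for a b p
    using that subseq_set_subset[of "[a, b]" p] by (auto simp: avoiders_iff)
  then show ?thesis
    by (intro set_eqI) (metis desc_top_iff add.right_neutral leD)
qed

text \<open>At most one value is constrained, so the order condition is vacuous. With
  \<open>desc_top_0\<close> this gives the two initial values of the recurrence.\<close>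

lemma desc_top_1 [simp]: "desc_top d k n (Suc 0) = avoiders d k n"
proof -
  have "a \<le> n \<and> b \<le> n \<and> a \<noteq> b" if "subseq [a, b] p" "p \<in> avoiders d k n" for a b p
    using that subseq_set_subset[of "[a, b]" p] subseq_distinct[of "[a, b]" p]
    by (auto simp: avoiders_iff)
  then show ?thesis
    by (intro set_eqI) (unfold desc_top_iff, fastforce)
qed

text \<open>A leading \<open>Suc n\<close> is the first of the \<open>Suc m\<close> largest values
  and precedes the others automatically; the rest are the \<open>m\<close> largest of
  \<open>q\<close>.\<close>

lemma desc_top_Cons_max_iff:
  assumes "1 \<le> d" "d < k"
  shows "Suc n # q \<in> desc_top d k (Suc n) (Suc m) \<longleftrightarrow> q \<in> desc_top d k n m"
proof -
  have "\<forall>v\<in>set q. v < Suc n" if "q \<in> avoiders d k n"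
    using that by (auto simp: avoiders_iff)
  then show ?thesis
    using Cons_max_avoiders_iff[OF assms] by (auto simp: desc_top_def)
qed

lemma card_desc_top_hd_max:
  assumes "1 \<le> d" "d < k"
  shows "card {p \<in> desc_top d k (Suc n) (Suc m). hd p \<noteq> Suc n} + card (desc_top d k n m) =
    card (desc_top d k (Suc n) (Suc m))"
proof -
  have "{p \<in> desc_top d k (Suc n) (Suc m). hd p = Suc n} = (#) (Suc n) ` desc_top d k n m"
    (is "?L = ?R")
  proof
    show "?L \<subseteq> ?R"
    proof
      fix p assume p: "p \<in> ?L"
      then have "p = Suc n # tl p"
        using avoiders_Suc_hd(1)[of p d k n] by (simp add: desc_top_def)
      then obtain q where "p = Suc n # q" by blast
      with p show "p \<in> ?R"
        using desc_top_Cons_max_iff[OF assms, of n q m] by blast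
    qed
    show "?R \<subseteq> ?L"
      using desc_top_Cons_max_iff[OF assms] by auto
  qed
  then have "card {p \<in> desc_top d k (Suc n) (Suc m). hd p = Suc n} = card (desc_top d k n m)"
    by (simp add: card_image)
  moreover have "card (desc_top d k (Suc n) (Suc m)) =
      card {p \<in> desc_top d k (Suc n) (Suc m). hd p \<noteq> Suc n} +
      card {p \<in> desc_top d k (Suc n) (Suc m). hd p = Suc n}"
    by (subst card_Un_disjoint[symmetric]) (auto intro: arg_cong[where f = card])
  ultimately show ?thesis by simp
qed

lemma desc_top_Suc_subset: "desc_top d k n (Suc m) \<subseteq> desc_top d k n m"
  by (auto simp: desc_top_iff)

text \<open>Losing membership when \<open>m\<close> grows means that the newly constrained value, n
  + 1 - m, precedes a larger one. A larger head other than \<open>Suc n\<close> would form an ascent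
  with \<open>Suc n\<close> among the \<open>m\<close> largest values, and a smaller head would
  complete a 123, so that value is the head itself.\<close>

lemma desc_top_ascent_eq:
  assumes "1 \<le> m" "m \<le> n"
  shows "{p \<in> desc_top d k (Suc n) m. hd p \<noteq> Suc n} - desc_top d k (Suc n) (Suc m) =
    {p \<in> avoiders d k (Suc n). hd p + m = Suc n}" (is "?L = ?R")
proof
  show "?L \<subseteq> ?R"
  proof
    fix p assume "p \<in> ?L"
    then have p: "p \<in> avoiders d k (Suc n)" "hd p \<noteq> Suc n"
      and desc: "\<And>a b. subseq [a, b] p \<Longrightarrow> Suc n < a + m \<Longrightarrow> Suc n < b + m \<Longrightarrow> b < a"
      and "p \<notin> desc_top d k (Suc n) (Suc m)"
      by (auto simp: desc_top_iff)
    then obtain a b where ab: "subseq [a, b] p" "Suc n < a + Suc m" "Suc n < b + Suc m" "\<not> b < a"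
      unfolding desc_top_iff by blast
    have dist: "distinct p" and set_p: "set p = {1..Suc n}" and av: "avoids p [1, 2, 3]"
      using p(1) by (auto simp: avoiders_iff)
    have "a < b"
      using ab(4) subseq_distinct[OF ab(1) dist] by simp
    \<comment> \<open>The pair violates the condition for \<open>Suc m\<close> but not for
      \<open>m\<close>, so its smaller element is the value just added.\<close>
    with desc[OF ab(1)] ab have a: "a + m = Suc n" by linarith
    define h r where "h = hd p" and "r = tl p"
    have hr: "p = h # r"
      using avoiders_Suc_hd(1)[OF p(1)] by (simp add: h_def r_def)
    have "h + m = Suc n"
    proof (rule ccontr)
      assume neq: "h + m \<noteq> Suc n"
      show False
      proof (cases "Suc n < h + m")
        case True
        have "h \<noteq> Suc n" using p(2) by (simp add: h_def)
        moreover have "Suc n \<in> set (h # r)" using set_p hr by simp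
        ultimately have "subseq [h, Suc n] p"
          by (simp add: hr subseq_singleton_left)
        with desc True assms(1) have "Suc n < h" by simp
        moreover have "h \<le> Suc n" using avoiders_Suc_hd(3)[OF p(1)] by (simp add: h_def)
        ultimately show False by simp
      next
        \<comment> \<open>Here \<open>h\<close>, \<open>a\<close>, \<open>b\<close> is a copy of
          123.\<close>
        case False
        then have "h < a" using a neq by simp
        then have "subseq [a, b] r" using ab(1) hr by simp
        then have "subseq [h, a, b] p" using hr by simp
        with av \<open>h < a\<close> \<open>a < b\<close> show False
          unfolding avoids_123_iff by blast
      qed
    qed
    with p(1) show "p \<in> ?R" by (simp add: h_def)
  qed
  show "?R \<subseteq> ?L"
  proof
    fix p assume p: "p \<in> ?R"
    define h r where "h = hd p" and "r = tl p"
    have hr: "p = h # r"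
      using avoiders_Suc_hd(1)[of p d k n] p by (simp add: h_def r_def)
    have h: "h + m = Suc n" using p by (simp add: h_def)
    have dist: "distinct (h # r)" and set_p: "set (h # r) = {1..Suc n}"
      and av: "avoids (h # r) [1, 2, 3]"
      using p hr by (auto simp: avoiders_iff)
    have "Suc n < v + m \<longleftrightarrow> h < v" for v
      using h by linarith
    then have "filter (\<lambda>v. Suc n < v + m) p = filter (\<lambda>v. h < v) r"
      by (simp add: hr)
    then have top: "p \<in> desc_top d k (Suc n) m"
      using p avoids_123_Cons_iff[OF dist] av by (simp add: desc_top_def)
    \<comment> \<open>The head is below \<open>Suc n\<close> because \<open>m\<close> is positive,
      so the two form an ascent among the \<open>Suc m\<close> largest values.\<close>
    have "Suc n \<in> set (h # r)" using set_p by simp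
    then have "subseq [h, Suc n] p"
      using h assms(1) by (auto simp: hr subseq_singleton_left)
    moreover have "Suc n < h + Suc m" "Suc n < Suc n + Suc m" "\<not> Suc n < h"
      using h by auto
    ultimately have "p \<notin> desc_top d k (Suc n) (Suc m)"
      unfolding desc_top_iff by blast
    with top show "p \<in> ?L"
      using h assms(1) by (simp add: h_def)
  qed
qed

text \<open>With heads other than \<open>Suc n\<close>, passing from \<open>m\<close> to
  \<open>Suc m\<close> loses $E(n,m)$ permutations, those with head n + 1 - m. The permutations with
  head \<open>Suc n\<close> on the left number $E(n,m)$ as well, so the two cancel.\<close>

lemma card_desc_top_rec:
  assumes "1 \<le> m" "m < d" "d < k" "m \<le> n"
  shows "card (desc_top d k (Suc n) (Suc m)) =
    card {p \<in> desc_top d k (Suc n) m. hd p \<noteq> Suc n}"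
proof -
  define A where "A = {p \<in> desc_top d k (Suc n) m. hd p \<noteq> Suc n}"
  define B where "B = {p \<in> desc_top d k (Suc n) (Suc m). hd p \<noteq> Suc n}"
  have "A - desc_top d k (Suc n) (Suc m) = A - B"
    by (auto simp: A_def B_def)
  then have "card (A - B) = card (desc_top d k n m)"
    using card_avoiders_hd[OF assms(2-4)] desc_top_ascent_eq[OF assms(1,4)]
    by (simp add: A_def)
  moreover have "B \<subseteq> A" "finite A"
    using desc_top_Suc_subset[of d k "Suc n" m] by (auto simp: A_def B_def desc_top_def)
  then have "card A = card B + card (A - B)"
    by (metis card_Diff_subset card_mono finite_subset le_add_diff_inverse)
  ultimately show ?thesis
    using card_desc_top_hd_max[of d k n m] assms by (simp add: A_def B_def)
qed

text \<open>Two-step induction: separating the permutations with head \<open>n\<close> in $E(n,m+1)$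
  yields $E(n,m+2) + E(n-1,m) = E(n,m+1)$, the recurrence of the alternating sum.\<close>

lemma card_desc_top:
  assumes "1 \<le> d" "d < k" "m \<le> d" "m \<le> n"
  shows "int (card (desc_top d k n m)) = chebyshev_sum (f_count d k) n m"
  using assms(3,4)
proof (induction m arbitrary: n rule: induct_nat_012)
  case (ge2 m)
  then obtain n' where n: "n = Suc n'" by (cases n) auto
  have "card (desc_top d k n (Suc (Suc m))) + card (desc_top d k n' m) =
      card (desc_top d k n (Suc m))"
    using card_desc_top_rec[of "Suc m" d k n'] card_desc_top_hd_max[of d k n' m] assms(1,2) ge2.prems
    by (simp add: n)
  then show ?case
    using ge2.IH(1)[of n'] ge2.IH(2)[of n] ge2.prems n chebyshev_sum_rec[of "f_count d k" n' m]
    by simp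
qed (simp_all add: f_count_def)

subsection \<open>The count of decreasing prefixes\<close>

lemma desc_prefix_1: "desc_prefix d k n 1 x = {p \<in> avoiders d k n. hd p + x \<le> n}"
  unfolding desc_prefix_def by (simp add: sorted_wrt01)

text \<open>Raising \<open>x\<close> by one discards the avoiders with head n - x, of which there
  are $E(n-1,x)$. This is again the recurrence, started at $F(n,1,0) = f_n$.\<close>

lemma card_desc_prefix_1:
  assumes "1 \<le> d" "d < k" "x \<le> d" "Suc x \<le> n"
  shows "int (card (desc_prefix d k n 1 x)) = chebyshev_sum (f_count d k) n (Suc x)"
  using assms(3,4)
proof (induction x)
  case 0
  have "hd p \<le> n" if "p \<in> avoiders d k n" for p
    using avoiders_Suc_hd(3)[of p d k "n - 1"] that 0 by simp
  then have "desc_prefix d k n 1 0 = avoiders d k n"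
    unfolding desc_prefix_1 by auto
  then show ?case by (simp add: f_count_def)
next
  case (Suc x)
  then obtain n' where n: "n = Suc n'" by (cases n) auto
  have "desc_prefix d k n 1 x - desc_prefix d k n 1 (Suc x) =
      {p \<in> avoiders d k (Suc n'). hd p + x = Suc n'}"
    unfolding desc_prefix_1 n by auto
  then have "card (desc_prefix d k n 1 x - desc_prefix d k n 1 (Suc x)) = card (desc_top d k n' x)"
    using card_avoiders_hd[of x d k n'] Suc.prems assms(2) n by simp
  moreover have "desc_prefix d k n 1 (Suc x) \<subseteq> desc_prefix d k n 1 x"
    unfolding desc_prefix_1 by auto
  ultimately have "card (desc_prefix d k n 1 x) =
      card (desc_prefix d k n 1 (Suc x)) + card (desc_top d k n' x)"
    by (metis card_Diff_subset card_mono finite_desc(1) le_add_diff_inverse)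
  then show ?case
    using Suc card_desc_top[of d k x n'] assms(1,2) n chebyshev_sum_rec[of "f_count d k" n' x]
    by simp
qed

text \<open>Induction on \<open>m\<close>, with \<open>x\<close> and \<open>n\<close> free: only the
  sum m + x enters the value, and each identity for the counts corresponds to a step of the
  recurrence.\<close>

lemma card_desc_prefix:
  assumes "1 \<le> d" "d < k" "1 \<le> m" "m \<le> k - d" "x \<le> d" "m + x \<le> n"
  shows "int (card (desc_prefix d k n m x)) = chebyshev_sum (f_count d k) n (m + x)"
  using assms(3-6)
proof (induction m arbitrary: x n rule: nat_induct_at_least)
  case base
  then show ?case
    using card_desc_prefix_1[of d k x n] assms(1,2) by simp
next
  case (Suc m)
  then obtain n' where n: "n = Suc n'" by (cases n) auto
  show ?case
  proof (cases x)
    \<comment> \<open>Trades one unit of \<open>m\<close> for one unit of slack, which is allowed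
      since \<open>d\<close> is at least 1.\<close>
    case 0
    then show ?thesis
      using card_desc_prefix_Suc_0[of d m k n'] Suc.IH[of 1 n] Suc.hyps Suc.prems assms(1) n by simp
  next
    case (Suc y)
    then show ?thesis
      using card_desc_prefix_ascent[of d m k n' y] Suc.IH[of x n] Suc.IH[of y n']
        Suc.hyps Suc.prems assms(1) n chebyshev_sum_rec[of "f_count d k" n' "m + y"] by simp
  qed
qed

section \<open>From index tuples to decreasing prefixes\<close>

text \<open>From index \<open>j\<close> on there are \<open>length xs - j\<close> strictly
  decreasing positive integers. Hence the lower bounds in \<open>I_tuples\<close> hold
  automatically.\<close>

lemma decreasing_nth_ge:
  assumes "sorted_wrt (>) xs" "\<forall>v \<in> set xs. 0 < v" "j < length xs"
  shows "length xs - j \<le> xs ! j"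
  using assms
proof (induction xs arbitrary: j)
  case (Cons y ys)
  show ?case
  proof (cases j)
    case 0
    show ?thesis
    proof (cases ys)
      case (Cons z zs)
      then have "length ys \<le> ys ! 0" "ys ! 0 < y"
        using Cons.IH[of 0] Cons.prems by auto
      then show ?thesis using 0 by simp
    qed (use 0 Cons.prems in auto)
  next
    case (Suc i)
    then show ?thesis using Cons.IH[of i] Cons.prems by simp
  qed
qed simp

text \<open>The upper bounds in \<open>I_tuples\<close> compare neighbours in the list with its
  bound prepended; transitivity of the order does the rest.\<close>

lemma Cons_less_nth_iff_sorted_wrt:
  fixes xs :: "nat list"
  shows "(\<forall>j<length xs. xs ! j < (b # xs) ! j) \<longleftrightarrow> sorted_wrt (>) (b # xs)"
  by (simp add: sorted_wrt_iff_nth_Suc_transp[OF transp_on_greater] del: sorted_wrt.simps)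

lemma take_in_I_tuples_iff:
  assumes "p \<in> avoiders d k n" "1 \<le> m" "m \<le> n" "d \<le> n"
  shows "take m p \<in> I_tuples d n m \<longleftrightarrow> p \<in> desc_prefix d k n m d"
proof -
  define xs where "xs = take m p"
  have len: "length xs = m"
    using assms length_avoiders[of p d k n] by (simp add: xs_def)
  have hd: "xs = hd p # tl xs"
    using assms length_avoiders[of p d k n] unfolding xs_def
    by (cases p) (auto simp: take_Cons split: nat.splits)
  have pos: "\<forall>v \<in> set xs. 0 < v"
    using assms(1) set_take_subset[of m p] by (auto simp: xs_def avoiders_iff)
  have "xs \<in> I_tuples d n m \<longleftrightarrow> (\<forall>j<m. m - j \<le> xs ! j) \<and> sorted_wrt (>) ((n + 1 - d) # xs)"
    unfolding I_tuples_def Cons_less_nth_iff_sorted_wrt[symmetric] using len by blast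
  also have "\<dots> \<longleftrightarrow> sorted_wrt (>) ((n + 1 - d) # xs)"
    using decreasing_nth_ge[OF _ pos] len by auto
  also have "\<dots> \<longleftrightarrow> sorted_wrt (>) xs \<and> hd p < n + 1 - d"
  proof -
    have "\<forall>v\<in>set xs. v \<le> hd p" if "sorted_wrt (>) xs"
      using that by (subst hd, subst (asm) hd) auto
    moreover have "hd p \<in> set xs" by (subst hd) simp
    ultimately show ?thesis by fastforce
  qed
  finally show ?thesis
    using assms(1,4) by (auto simp: xs_def desc_prefix_def)
qed

theorem theorem2p5:
  fixes k d n m :: nat
  assumes "k \<ge> 3" and "1 \<le> d" and "d \<le> k - 1" and "k - d \<ge> d"
    and "n \<ge> k" and "1 \<le> m" and "m \<le> k - d"
  shows "int (A_sum d k n m) =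
    (\<Sum>i = 0..m + d. (- 1) ^ i * int ((m + d - i) choose i) * int (f_count d k (n - i)))"
proof -
  have "A_sum d k n m = (\<Sum>is \<in> I_tuples d n m. card {p \<in> avoiders d k n. take m p = is})"
    unfolding A_sum_def g_count_def by (intro sum.cong) (auto simp: I_tuples_def)
  \<comment> \<open>Different tuples prescribe different prefixes, so the classes are
    disjoint.\<close>
  also have "\<dots> = card (\<Union>is \<in> I_tuples d n m. {p \<in> avoiders d k n. take m p = is})"
    by (rule card_UN_disjoint[symmetric]) (auto simp: finite_I_tuples)
  also have "(\<Union>is \<in> I_tuples d n m. {p \<in> avoiders d k n. take m p = is}) = desc_prefix d k n m d"
    using take_in_I_tuples_iff[of _ d k n m] assms by (auto simp: desc_prefix_def)
  finally show ?thesis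
    \<comment> \<open>The slack is x = d, and m + d is at most \<open>k\<close>, hence at most
      \<open>n\<close>.\<close>
    using card_desc_prefix[of d k m d n] assms by (simp add: chebyshev_sum_def)
qed

end
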